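(* Consider a $K$-armed Bernoulli bandit problem ($K\ge 2$) with actions $a_1,\dots,a_K$, where the highest reward probability among all the actions is $p_1$ and the second-highest is $p_2$, with $p_1>p_2$. Let the agent follow the $RS$ algorithm with aspiration level $R=(p_1+p_2)/2$. Then there exist a constant $M<\infty$ and a monotonically increasing function $f(s)$ of the step number $s$ such that $\mathrm{regret}(s)<f(s)$ for every $s$ and $f(s)\to M$ as $s\to\infty$. Thus $\mathrm{regret}(s)<M$ for every $s$.
   Context: Bandit problem: there are $K$ actions $a_1,\dots,a_K$. At each step the agent chooses one action; choosing $a_i$ yields reward $1$ with probability $p_i$ and reward $0$ with probability $1-p_i$, independently over choices. The $p_i$ are unknown to the agent. Actions are labelled so that $a_1$ has the highest reward probability $p_1$ and $a_2$ the second-highest $p_2$. Notation: after $s$ steps, $n_i(s)$ is the number of times $a_i$ has been chosen and $n_i^1(s)$ is the number of times choosing $a_i$ gave reward $1$. The mean reward is $E(a_i,s)=n_i^1(s)/n_i(s)$. $RS$ (risk-sensitive satisficing) value with aspiration level $R$: $RS(a_i,s)=n_i(s)\,(E(a_i,s)-R)=n_i^1(s)-n_i(s)R$ (so the value is $0$ while $n_i(s)=0$). $RS$ algorithm: greedy choice with respect to the $RS$ value, i.e. after $s$ steps the next action chosen is an action maximizing $RS(\cdot,s)$. Regret after $s$ steps: $\mathrm{regret}(s)=\sum_{i=1}^K (p_1-p_i)\,\mathbb{E}[n_i(s)]$, where $\mathbb{E}$ denotes expectation. *)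

theory Defs
  imports "HOL-Probability.Probability"
begin

text \<open>
  A history lists the pairs (action chosen, reward received), most recent step first;
  \<^term>\<open>True\<close> stands for reward 1 and \<^term>\<open>False\<close> for reward 0.
\<close>

type_synonym history = "(nat \<times> bool) list"

definition num_chosen :: "nat \<Rightarrow> history \<Rightarrow> nat" where
  "num_chosen i h = length (filter (\<lambda>(a, r). a = i) h)"

definition num_rewarded :: "nat \<Rightarrow> history \<Rightarrow> nat" where
  "num_rewarded i h = length (filter (\<lambda>(a, r). a = i \<and> r) h)"

definition mean_reward :: "nat \<Rightarrow> history \<Rightarrow> real" where
  "mean_reward i h = real (num_rewarded i h) / real (num_chosen i h)"

definition RS :: "real \<Rightarrow> nat \<Rightarrow> history \<Rightarrow> real" where
  "RS R i h = real (num_chosen i h) * (mean_reward i h - R)"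

text \<open>
  The convention \<open>x / 0 = 0\<close> does no harm: the value of an action never chosen is 0.
\<close>

lemma RS_eq: "RS R i h = real (num_rewarded i h) - real (num_chosen i h) * R"
proof -
  have "num_rewarded i h \<le> num_chosen i h"
    unfolding num_rewarded_def num_chosen_def by (induction h) auto
  then show ?thesis
    by (cases "num_chosen i h = 0") (auto simp: RS_def mean_reward_def algebra_simps)
qed

text \<open>
  The rule by which the agent chooses is a map from the history to a distribution on the
  actions. Being an instance of the RS algorithm constrains only the support of that
  distribution, so ties may be broken in any way, at random or depending on the history.
\<close>

definition RS_algorithm :: "nat \<Rightarrow> real \<Rightarrow> (history \<Rightarrow> nat pmf) \<Rightarrow> bool" where
  "RS_algorithm K R \<pi> \<longleftrightarrow>
     (\<forall>h. \<forall>a \<in> set_pmf (\<pi> h). is_arg_max (\<lambda>i. RS R i h) (\<lambda>i. i \<in> {1..K}) a)"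

text \<open>
  Law of the history after a given number of steps. At each step the reward is drawn
  afresh, given the action, which makes rewards independent over choices.
\<close>

primrec history_pmf :: "(nat \<Rightarrow> real) \<Rightarrow> (history \<Rightarrow> nat pmf) \<Rightarrow> nat \<Rightarrow> history pmf" where
  "history_pmf p \<pi> 0 = return_pmf []"
| "history_pmf p \<pi> (Suc s) =
     do {
       h \<leftarrow> history_pmf p \<pi> s;
       a \<leftarrow> \<pi> h;
       r \<leftarrow> bernoulli_pmf (p a);
       return_pmf ((a, r) # h)
     }"

definition regret :: "nat \<Rightarrow> (nat \<Rightarrow> real) \<Rightarrow> (history \<Rightarrow> nat pmf) \<Rightarrow> nat \<Rightarrow> real" where
  "regret K p \<pi> s =
     (\<Sum>i = 1..K. (p 1 - p i) *
        measure_pmf.expectation (history_pmf p \<pi> s) (\<lambda>h. real (num_chosen i h)))"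

end

theory Submission
  imports Defs "HOL-Real_Asymp.Real_Asymp"
begin

text \<open>
  Write \<open>X\<^sub>i\<close> for the RS value of \<open>a\<^sub>i\<close> and \<open>\<delta> = (p\<^sub>1 - p\<^sub>2) / 2\<close>. Then \<open>X\<^sub>1\<close> has drift \<open>\<delta>\<close> when
  \<open>a\<^sub>1\<close> is chosen, and every other \<open>X\<^sub>i\<close> has drift at most \<open>-\<delta>\<close> when \<open>a\<^sub>i\<close> is chosen, so
  \<open>\<delta> n\<^sub>i + X\<^sub>i\<close> is a supermartingale. As \<open>a\<^sub>i\<close> is only chosen when \<open>X\<^sub>i \<ge> X\<^sub>1\<close>, the value
  \<open>X\<^sub>i\<close> never falls below \<open>m - 1\<close>, where \<open>m\<close> is the running minimum of \<open>X\<^sub>1\<close>. Hence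
  \<open>\<delta> E[n\<^sub>i] \<le> 1 + E[-m]\<close>. Finally \<open>-m + exp (-\<delta> (X\<^sub>1 - m)) / \<delta>\<close> is a nonnegative
  supermartingale dominating \<open>-m\<close>, which gives \<open>E[-m] \<le> 1 / \<delta>\<close> at every step.
\<close>

section \<open>Exponential moment of a single reward\<close>

lemma exp_le_quadratic:
  fixes x :: real
  assumes "\<bar>x\<bar> \<le> 1"
  shows "exp x \<le> 1 + x + x\<^sup>2"
proof (cases "x \<ge> 0")
  case True
  then show ?thesis using assms by (intro exp_bound) auto
next
  case False
  define y where "y = - x"
  have y: "y > 0" using False by (simp add: y_def)
  have "exp x = 1 / exp y" by (simp add: y_def exp_minus field_simps)
  also have "\<dots> \<le> 1 / (1 + y)"
    using y exp_ge_add_one_self[of y] by (intro divide_left_mono) auto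
  \<comment> \<open>Here \<open>(1 + y) * (1 - y + y^2) = 1 + y^3\<close>, which is at least
    1.\<close>
  also have "\<dots> \<le> 1 - y + y\<^sup>2"
    using y by (simp add: field_simps power2_eq_square)
  finally show ?thesis by (simp add: y_def)
qed

text \<open>To second order the moment is at most
  \<open>1 - \<theta> * (q - R) + \<theta>^2\<close>, so an exponent up to the drift
  \<open>q - R\<close> is small enough.\<close>

lemma bernoulli_exp_moment_le_1:
  fixes q R \<theta> :: real
  assumes "0 \<le> q" "q \<le> 1" "0 \<le> R" "R \<le> 1" "0 \<le> \<theta>" "\<theta> \<le> q - R"
  shows "q * exp (- \<theta> * (1 - R)) + (1 - q) * exp (\<theta> * R) \<le> 1"
proof -
  have \<theta>: "\<theta> \<le> 1" using assms by linarith
  have A: "exp (- \<theta> * (1 - R)) \<le> 1 - \<theta> * (1 - R) + \<theta>\<^sup>2"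
  proof -
    have "(\<theta> * (1 - R))\<^sup>2 \<le> \<theta>\<^sup>2"
      using assms by (intro power_mono mult_left_le) auto
    moreover have "\<theta> * (1 - R) \<le> 1" using assms \<theta> by (intro mult_le_one) auto
    moreover have "\<theta> * (1 - R) \<ge> 0" using assms by simp
    ultimately show ?thesis using exp_le_quadratic[of "- (\<theta> * (1 - R))"] by simp
  qed
  have B: "exp (\<theta> * R) \<le> 1 + \<theta> * R + \<theta>\<^sup>2"
  proof -
    have "(\<theta> * R)\<^sup>2 \<le> \<theta>\<^sup>2"
      using assms by (intro power_mono mult_left_le) auto
    moreover have "\<theta> * R \<le> 1" using assms \<theta> by (intro mult_le_one) auto
    moreover have "\<theta> * R \<ge> 0" using assms by simp
    ultimately show ?thesis using exp_le_quadratic[of "\<theta> * R"] by simp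
  qed
  have "q * exp (- \<theta> * (1 - R)) + (1 - q) * exp (\<theta> * R)
      \<le> q * (1 - \<theta> * (1 - R) + \<theta>\<^sup>2) + (1 - q) * (1 + \<theta> * R + \<theta>\<^sup>2)"
    using A B assms by (intro add_mono mult_left_mono) auto
  also have "\<dots> = 1 - \<theta> * (q - R) + \<theta>\<^sup>2"
    by (simp add: algebra_simps)
  also have "\<dots> \<le> 1"
    using mult_left_mono[OF assms(6) assms(5)] by (simp add: power2_eq_square)
  finally show ?thesis .
qed

section \<open>Evolution of values and expectations along histories\<close>

lemma num_chosen_Cons:
  "num_chosen i ((a, r) # h) = num_chosen i h + of_bool (a = i)"
  by (simp add: num_chosen_def)

lemma num_rewarded_Cons:
  "num_rewarded i ((a, r) # h) = num_rewarded i h + of_bool (a = i \<and> r)"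
  by (simp add: num_rewarded_def)

lemma RS_Nil [simp]: "RS R i [] = 0"
  by (simp add: RS_def num_chosen_def)

lemma RS_Cons: "RS R i ((a, r) # h) = RS R i h + (if a = i then of_bool r - R else 0)"
  by (simp add: RS_eq num_chosen_Cons num_rewarded_Cons algebra_simps)

lemma RS_algorithmD:
  assumes "RS_algorithm K R \<pi>" "a \<in> set_pmf (\<pi> h)"
  shows "a \<in> {1..K}" and "i \<in> {1..K} \<Longrightarrow> RS R i h \<le> RS R a h"
  using assms by (auto simp: RS_algorithm_def is_arg_max_linorder)

lemma finite_set_pmf_RS_algorithm:
  assumes "RS_algorithm K R \<pi>"
  shows "finite (set_pmf (\<pi> h))"
  by (rule finite_subset[of _ "{1..K}"]) (use RS_algorithmD(1)[OF assms] in auto)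

lemma finite_set_history_pmf:
  assumes "\<And>h. finite (set_pmf (\<pi> h))"
  shows "finite (set_pmf (history_pmf p \<pi> s))"
  by (induction s) (auto intro!: finite_UN_I assms)

lemma expectation_mono_finite:
  fixes f g :: "'a \<Rightarrow> real"
  assumes "finite (set_pmf q)" "\<And>x. x \<in> set_pmf q \<Longrightarrow> f x \<le> g x"
  shows "measure_pmf.expectation q f \<le> measure_pmf.expectation q g"
  using assms by (intro integral_mono_AE integrable_measure_pmf_finite) (auto simp: AE_measure_pmf_iff)

lemma expectation_bind_finite:
  fixes F :: "'b \<Rightarrow> real"
  assumes "finite (set_pmf q)" "\<And>x. x \<in> set_pmf q \<Longrightarrow> finite (set_pmf (g x))"
  shows "measure_pmf.expectation (q \<bind> g) F
       = measure_pmf.expectation q (\<lambda>x. measure_pmf.expectation (g x) F)"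
  using assms
  by (simp add: pmf_expectation_bind[of "set_pmf q"] integral_measure_pmf[of "set_pmf q"])

text \<open>Integrating the one-step inequality over the next action and the past shows that the
  expectation of \<open>F\<close> never increases. Finite supports settle integrability.\<close>

lemma expectation_supermartingale_le:
  fixes F :: "history \<Rightarrow> real"
  assumes fin: "\<And>h. finite (set_pmf (\<pi> h))"
    and prob: "\<And>h a. a \<in> set_pmf (\<pi> h) \<Longrightarrow> 0 \<le> p a \<and> p a \<le> 1"
    and step: "\<And>h a. a \<in> set_pmf (\<pi> h) \<Longrightarrow>
                 p a * F ((a, True) # h) + (1 - p a) * F ((a, False) # h) \<le> F h"
  shows "measure_pmf.expectation (history_pmf p \<pi> s) F \<le> F []"
proof (induction s)
  case (Suc s)
  have "measure_pmf.expectation (history_pmf p \<pi> (Suc s)) F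
      = measure_pmf.expectation (history_pmf p \<pi> s) (\<lambda>h.
          measure_pmf.expectation (\<pi> h) (\<lambda>a.
            measure_pmf.expectation (bernoulli_pmf (p a)) (\<lambda>r. F ((a, r) # h))))"
    by (simp add: expectation_bind_finite finite_set_history_pmf fin)
  also have "\<dots> \<le> measure_pmf.expectation (history_pmf p \<pi> s) F"
  proof (intro expectation_mono_finite finite_set_history_pmf fin)
    fix h
    have "measure_pmf.expectation (\<pi> h) (\<lambda>a.
            measure_pmf.expectation (bernoulli_pmf (p a)) (\<lambda>r. F ((a, r) # h)))
        \<le> measure_pmf.expectation (\<pi> h) (\<lambda>_. F h)"
      using step prob by (intro expectation_mono_finite fin) (simp add: mult.commute)
    then show "measure_pmf.expectation (\<pi> h) (\<lambda>a.
            measure_pmf.expectation (bernoulli_pmf (p a)) (\<lambda>r. F ((a, r) # h))) \<le> F h"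
      by simp
  qed
  finally show ?case using Suc.IH by linarith
qed simp

section \<open>Potential of the running minimum\<close>

primrec min_RS :: "real \<Rightarrow> nat \<Rightarrow> history \<Rightarrow> real" where
  "min_RS R i [] = 0"
| "min_RS R i (e # h) = min (min_RS R i h) (RS R i (e # h))"

lemma min_RS_le_RS: "min_RS R i h \<le> RS R i h"
  by (cases h) auto

text \<open>
  The weight \<open>1 / \<theta>\<close> of the exponential is the least for which a new minimum, lower by
  \<open>d\<close>, is paid for: \<open>d + 1 / \<theta> \<le> exp (\<theta> d) / \<theta>\<close>.
\<close>

definition min_potential :: "real \<Rightarrow> real \<Rightarrow> nat \<Rightarrow> history \<Rightarrow> real" where
  "min_potential \<theta> R i h = - min_RS R i h + exp (- \<theta> * (RS R i h - min_RS R i h)) / \<theta>"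

text \<open>Keeping the old minimum on the right leaves a plain exponential to average. The two
  sides differ only at a new minimum, where \<open>1 + x \<le> exp x\<close> applies.\<close>

lemma min_potential_Cons_le:
  assumes "\<theta> > 0"
  shows "min_potential \<theta> R i (e # h)
       \<le> - min_RS R i h + exp (- \<theta> * (RS R i (e # h) - min_RS R i h)) / \<theta>"
proof (cases "min_RS R i h \<le> RS R i (e # h)")
  case False
  define d where "d = min_RS R i h - RS R i (e # h)"
  have "d + 1 / \<theta> = (1 + \<theta> * d) / \<theta>" using assms by (simp add: field_simps)
  also have "\<dots> \<le> exp (\<theta> * d) / \<theta>"
    using assms exp_ge_add_one_self[of "\<theta> * d"] by (intro divide_right_mono) auto
  finally show ?thesis using False
    by (simp add: min_potential_def d_def algebra_simps)
qed (simp add: min_potential_def)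

lemma min_potential_step:
  assumes "0 \<le> p i" "p i \<le> 1" "0 \<le> R" "R \<le> 1" "0 < \<theta>" "\<theta> \<le> p i - R"
  shows "p a * min_potential \<theta> R i ((a, True) # h)
       + (1 - p a) * min_potential \<theta> R i ((a, False) # h) \<le> min_potential \<theta> R i h"
proof (cases "a = i")
  case False
  \<comment> \<open>The value of \<open>i\<close> does not move and was already at least the
    minimum, so the minimum stays as well.\<close>
  then have "min_potential \<theta> R i ((a, r) # h) = min_potential \<theta> R i h" for r
    using min_RS_le_RS[of R i h] by (simp add: min_potential_def RS_Cons)
  then show ?thesis by (simp add: algebra_simps)
next
  case True
  define m where "m = min_RS R i h"
  define c where "c = exp (- \<theta> * (RS R i h - m)) / \<theta>"
  have c: "c \<ge> 0" using assms by (simp add: c_def)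
  have T: "min_potential \<theta> R i ((i, True) # h) \<le> - m + c * exp (- \<theta> * (1 - R))"
    using min_potential_Cons_le[OF assms(5), of R i "(i, True)" h]
    by (simp add: RS_Cons c_def m_def algebra_simps flip: exp_add)
  have F: "min_potential \<theta> R i ((i, False) # h) \<le> - m + c * exp (\<theta> * R)"
    using min_potential_Cons_le[OF assms(5), of R i "(i, False)" h]
    by (simp add: RS_Cons c_def m_def algebra_simps flip: exp_add)
  have "p i * min_potential \<theta> R i ((i, True) # h)
       + (1 - p i) * min_potential \<theta> R i ((i, False) # h)
      \<le> p i * (- m + c * exp (- \<theta> * (1 - R))) + (1 - p i) * (- m + c * exp (\<theta> * R))"
    using T F assms by (intro add_mono mult_left_mono) auto
  also have "\<dots> = - m + c * (p i * exp (- \<theta> * (1 - R)) + (1 - p i) * exp (\<theta> * R))"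
    by (simp add: algebra_simps)
  also have "\<dots> \<le> - m + c * 1"
    using assms c by (intro add_left_mono mult_left_mono bernoulli_exp_moment_le_1) auto
  also have "\<dots> = min_potential \<theta> R i h"
    by (simp add: min_potential_def m_def c_def)
  finally show ?thesis using True by simp
qed

section \<open>From the running minimum to the regret\<close>

text \<open>When \<open>i\<close> is chosen its value is at least that of \<open>j\<close>, and one
  step costs at most \<open>R \<le> 1\<close>. Otherwise its value stays put while the minimum can
  only fall.\<close>

lemma RS_ge_min_RS:
  assumes alg: "RS_algorithm K R \<pi>" and "j \<in> {1..K}" "R \<le> 1"
    and "h \<in> set_pmf (history_pmf p \<pi> s)"
  shows "min_RS R j h - 1 \<le> RS R i h"
  using assms(4)
proof (induction s arbitrary: h)
  case (Suc s)
  from Suc.prems obtain h' a r where h: "h = (a, r) # h'"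
    and h': "h' \<in> set_pmf (history_pmf p \<pi> s)" and a: "a \<in> set_pmf (\<pi> h')"
    by auto
  show ?case
  proof (cases "a = i")
    case True
    have "RS R j h' \<le> RS R i h'"
      using RS_algorithmD(2)[OF alg a assms(2)] True by simp
    then show ?thesis
      using min_RS_le_RS[of R j h'] assms(3) by (auto simp: h RS_Cons True min_def)
  next
    case False
    then show ?thesis using Suc.IH[OF h'] by (simp add: h RS_Cons)
  qed
qed simp

lemma expected_num_chosen_le:
  assumes alg: "RS_algorithm K R \<pi>"
    and prob: "\<And>i. i \<in> {1..K} \<Longrightarrow> 0 \<le> p i \<and> p i \<le> 1"
    and j: "j \<in> {1..K}" and R: "0 \<le> R" "R \<le> 1"
    and \<delta>: "0 < \<delta>" "\<delta> \<le> p j - R" "\<delta> \<le> R - p i"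
  shows "measure_pmf.expectation (history_pmf p \<pi> s) (\<lambda>h. real (num_chosen i h))
         \<le> (1 + 1 / \<delta>) / \<delta>"
proof -
  let ?H = "history_pmf p \<pi> s"
  let ?E = "measure_pmf.expectation ?H"
  note fin = finite_set_pmf_RS_algorithm[OF alg]
  have fin_H: "finite (set_pmf ?H)" by (intro finite_set_history_pmf fin)
  have int: "integrable (measure_pmf ?H) f" for f :: "history \<Rightarrow> real"
    by (rule integrable_measure_pmf_finite[OF fin_H])
  have prob': "0 \<le> p a \<and> p a \<le> 1" if "a \<in> set_pmf (\<pi> h)" for a h
    using prob RS_algorithmD(1)[OF alg that] by blast
  have E1: "?E (min_potential \<delta> R j) \<le> 1 / \<delta>"
    using expectation_supermartingale_le[of \<pi> p "min_potential \<delta> R j" s, OF fin prob']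
      min_potential_step[of p j R \<delta>] prob[OF j] R \<delta>
    by (simp add: min_potential_def)
  \<comment> \<open>Lowering the aspiration level by \<open>\<delta>\<close> adds
    \<open>\<delta>\<close> times the number of choices to the value: this is the supermartingale of
    \<open>i\<close>.\<close>
  have E2: "?E (RS (R - \<delta>) i) \<le> 0"
  proof -
    have "p a * RS (R - \<delta>) i ((a, True) # h) + (1 - p a) * RS (R - \<delta>) i ((a, False) # h)
          \<le> RS (R - \<delta>) i h" for a h
      using \<delta>(3) by (simp add: RS_Cons algebra_simps)
    then show ?thesis
      using expectation_supermartingale_le[of \<pi> p "RS (R - \<delta>) i" s, OF fin prob'] by simp
  qed
  have "?E (\<lambda>h. \<delta> * real (num_chosen i h))
      \<le> ?E (\<lambda>h. RS (R - \<delta>) i h + (1 + min_potential \<delta> R j h))"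
  proof (rule expectation_mono_finite[OF fin_H])
    fix h assume h: "h \<in> set_pmf ?H"
    have "\<delta> * real (num_chosen i h) = RS (R - \<delta>) i h - RS R i h"
      by (simp add: RS_eq algebra_simps)
    also have "\<dots> \<le> RS (R - \<delta>) i h + (1 - min_RS R j h)"
      using RS_ge_min_RS[OF alg j R(2) h, of i] by simp
    also have "\<dots> \<le> RS (R - \<delta>) i h + (1 + min_potential \<delta> R j h)"
      using \<delta> by (simp add: min_potential_def)
    finally show "\<delta> * real (num_chosen i h)
        \<le> RS (R - \<delta>) i h + (1 + min_potential \<delta> R j h)" .
  qed
  also have "\<dots> = ?E (RS (R - \<delta>) i) + (1 + ?E (min_potential \<delta> R j))"
    by (simp add: int)
  also have "\<dots> \<le> 1 + 1 / \<delta>" using E1 E2 by simp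
  finally have "\<delta> * ?E (\<lambda>h. real (num_chosen i h)) \<le> 1 + 1 / \<delta>" by simp
  then show ?thesis using \<delta> by (simp add: pos_le_divide_eq mult.commute)
qed

theorem proposition2:
  fixes K :: nat and p :: "nat \<Rightarrow> real" and R :: real
    and \<pi> :: "history \<Rightarrow> nat pmf"
  assumes "K \<ge> 2"
    and "\<And>i. i \<in> {1..K} \<Longrightarrow> 0 \<le> p i \<and> p i \<le> 1"
    and "p 1 > p 2"
    and "\<And>i. i \<in> {3..K} \<Longrightarrow> p i \<le> p 2"
    and "R = (p 1 + p 2) / 2"
    and "RS_algorithm K R \<pi>"
  shows "\<exists>(M :: real) (f :: nat \<Rightarrow> real).
           strict_mono f \<and> (\<forall>s. regret K p \<pi> s < f s) \<and> f \<longlonglongrightarrow> M \<and>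
           (\<forall>s. regret K p \<pi> s < M)"
proof -
  define \<delta> where "\<delta> = (p 1 - p 2) / 2"
  define B where "B = (\<Sum>i = 1..K. (p 1 - p i) * ((1 + 1 / \<delta>) / \<delta>))"
  have p12: "0 \<le> p 1" "p 1 \<le> 1" "0 \<le> p 2" "p 2 \<le> 1"
    using assms(1) assms(2)[of 1] assms(2)[of 2] by auto
  then have R01: "0 \<le> R" "R \<le> 1"
    using assms(5) by auto
  have regret_le: "regret K p \<pi> s \<le> B" for s
    unfolding regret_def B_def
  proof (rule sum_mono)
    fix i assume i: "i \<in> {1..K}"
    show "(p 1 - p i) * measure_pmf.expectation (history_pmf p \<pi> s) (\<lambda>h. real (num_chosen i h))
          \<le> (p 1 - p i) * ((1 + 1 / \<delta>) / \<delta>)"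
    \<comment> \<open>The best action may be chosen without bound, but its gap is 0.\<close>
    proof (cases "i = 1")
      case False
      then have "i = 2 \<or> i \<in> {3..K}" using i by auto
      then have "p i \<le> p 2" using assms(4) by auto
      then show ?thesis
        using assms(1,3,5) R01
        by (intro mult_left_mono expected_num_chosen_le[OF assms(6,2), where j = 1])
           (auto simp: \<delta>_def field_simps)
    qed simp
  qed
  \<comment> \<open>The regret may equal \<open>B\<close>, so \<open>?f\<close> must start strictly
    above it; the shift by 2 gives the initial value \<open>B + 1 / 2\<close>.\<close>
  let ?f = "\<lambda>s. B + 1 - 1 / real (s + 2)"
  have "strict_mono ?f"
    by (rule strict_monoI) (simp add: field_simps)
  moreover have "regret K p \<pi> s < ?f s" for s
  proof -
    have "1 / real (s + 2) < 1" by simp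
    then show ?thesis using regret_le[of s] by linarith
  qed
  moreover have "?f \<longlonglongrightarrow> B + 1"
    by real_asymp
  moreover have "regret K p \<pi> s < B + 1" for s
    using regret_le[of s] by simp
  ultimately show ?thesis by blast
qed

end
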